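(* Let $1\le p<\infty$ and let $f:[0,\infty]\to[0,\infty)$ be a sub-diagonal and sub-additive function. Let $\mathcal{D}_F$ be the set of persistence diagrams such that all points outside the diagonal have finite coordinates. Given $A\in\mathcal{D}$, there exists a unique $B\in\mathcal{D}_F$ such that $D_p^f(B\|A)=\inf\{D_p^f(C\|A): C\in\mathcal{D}_F\}$. Moreover, $B$ is the subset of $A$ obtained by removing all the (off-diagonal) points with infinite coordinates.
   Context: Write $\overline{\mathbb{R}}=\mathbb{R}\cup\{+\infty\}$. A persistence diagram is the union of a finite multiset of points $(x,y)\in\overline{\mathbb{R}}^2$ with $x<y$, together with all points $(x,x)\in\overline{\mathbb{R}}^2$ (the diagonal), each taken with infinite multiplicity. $\mathcal{D}$ is the set of all persistence diagrams. Injections between diagrams, sums over diagrams, and set differences are understood for multisets, i.e. elements are counted with multiplicity. For $a=(x_1,y_1)$, $b=(x_2,y_2)$ put $\|a-b\|_\infty=\max\{|x_1-x_2|,|y_1-y_2|\}$, where the absolute difference of two infinite coordinates is set to $0$ and that of a finite and an infinite coordinate is $\infty$. A function $f:[0,\infty]\to[0,\infty)$ is called sub-diagonal and sub-additive if it is continuous, $f(x)\le x$ for all $x\in[0,\infty]$, and $f(x+y)\le f(x)+f(y)$ for all $x,y\ge0$. Let $\lambda(x,y)=\left(\frac{x+y}{2},\frac{x+y}{2}\right)$ be the projection onto the diagonal. The $(f,p)$-Wasserstein divergence is $$D_p^f(A\|B)=\left(\inf_\gamma\left\{\sum_{a\in A}\|a-\gamma(a)\|_\infty^p+\sum_{b\in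 B\setminus\gamma(A)}f(\|b-\lambda(b)\|_\infty)^p\right\}\right)^{1/p},$$ the infimum being over all injections $\gamma:A\to B$ (values in $[0,\infty]$).
   Formalization: Uniqueness of B is stated only when f(x)>0 for all 0<x<∞, since it fails otherwise (f=0 and A with single off-diagonal point (0,1): both A and the empty diagram attain the infimum); that A without its infinite points attains the infimum is proved for every f. *)

theory Defs
  imports "HOL-Analysis.Analysis"
begin

section \<open>Persistence diagrams\<close>

text \<open>The line extended by plus infinity only; \<^typ>\<open>ereal\<close> also contains minus infinity.\<close>

definition Rbar :: "ereal set" where
  "Rbar = {x. x \<noteq> -\<infinity>}"

text \<open>A multiset with possibly infinite multiplicities is its multiplicity function into
  \<^typ>\<open>enat\<close>, so equality of diagrams is equality of multisets. The diagonal contains the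
  point at infinity in both coordinates.\<close>

type_synonym diagram = "ereal \<times> ereal \<Rightarrow> enat"

definition diagonal :: "(ereal \<times> ereal) set" where
  "diagonal = {(x, x) | x. x \<in> Rbar}"

definition add_diagonal :: "(ereal \<times> ereal) multiset \<Rightarrow> diagram" where
  "add_diagonal M = (\<lambda>z. enat (count M z) + (if z \<in> diagonal then \<infinity> else 0))"

definition diagrams :: "diagram set" where
  "diagrams = {add_diagonal M | M. \<forall>(x, y) \<in> set_mset M. x \<in> Rbar \<and> y \<in> Rbar \<and> x < y}"

definition finite_diagrams :: "diagram set" where
  "finite_diagrams = {D \<in> diagrams. \<forall>x y. D (x, y) \<noteq> 0 \<and> (x, y) \<notin> diagonal
      \<longrightarrow> \<bar>x\<bar> \<noteq> \<infinity> \<and> \<bar>y\<bar> \<noteq> \<infinity>}"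

definition remove_infinite :: "diagram \<Rightarrow> diagram" where
  "remove_infinite D = (\<lambda>(x, y).
      if (x, y) \<notin> diagonal \<and> (\<bar>x\<bar> = \<infinity> \<or> \<bar>y\<bar> = \<infinity>) then 0 else D (x, y))"

text \<open>The elements of a diagram counted with multiplicity: a point of multiplicity \<open>m\<close> has the
  copies numbered by all \<open>i < m\<close>. Injections, sums and set differences of diagrams are the
  ordinary ones for these sets.\<close>

definition elems :: "diagram \<Rightarrow> ((ereal \<times> ereal) \<times> nat) set" where
  "elems D = {(z, i). enat i < D z}"

definition injections ::
    "diagram \<Rightarrow> diagram \<Rightarrow> ((ereal \<times> ereal) \<times> nat \<Rightarrow> (ereal \<times> ereal) \<times> nat) set" where
  "injections A B = {\<gamma>. \<gamma> ` elems A \<subseteq> elems B \<and> inj_on \<gamma> (elems A)}"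

section \<open>The Wasserstein divergence\<close>

text \<open>The case distinction is needed because \<open>\<infinity> - \<infinity> = \<infinity>\<close> in \<^typ>\<open>ereal\<close>.\<close>

definition coord_dist :: "ereal \<Rightarrow> ereal \<Rightarrow> ennreal" where
  "coord_dist x y = (if x = \<infinity> \<and> y = \<infinity> then 0 else e2ennreal \<bar>x - y\<bar>)"

definition sup_dist :: "ereal \<times> ereal \<Rightarrow> ereal \<times> ereal \<Rightarrow> ennreal" where
  "sup_dist a b = max (coord_dist (fst a) (fst b)) (coord_dist (snd a) (snd b))"

definition diag_proj :: "ereal \<times> ereal \<Rightarrow> ereal \<times> ereal" where
  "diag_proj = (\<lambda>(x, y). ((x + y) / 2, (x + y) / 2))"

text \<open>Since the values are finite, they are taken in \<^typ>\<open>real\<close>.\<close>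

definition subdiag_subadd :: "(ennreal \<Rightarrow> real) \<Rightarrow> bool" where
  "subdiag_subadd f \<longleftrightarrow>
     (\<forall>x. 0 \<le> f x) \<and> continuous_on UNIV f \<and>
     (\<forall>x. ennreal (f x) \<le> x) \<and> (\<forall>x y. f (x + y) \<le> f x + f y)"

text \<open>Real powers on \<open>[0,\<infinity>]\<close>, used only for positive exponents.\<close>

definition epowr :: "ennreal \<Rightarrow> real \<Rightarrow> ennreal" where
  "epowr x p = (if x = \<infinity> then \<infinity> else ennreal (enn2real x powr p))"

definition matching_cost ::
    "real \<Rightarrow> (ennreal \<Rightarrow> real) \<Rightarrow> diagram \<Rightarrow> diagram \<Rightarrow>
      ((ereal \<times> ereal) \<times> nat \<Rightarrow> (ereal \<times> ereal) \<times> nat) \<Rightarrow> ennreal" where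
  "matching_cost p f A B \<gamma> =
     (\<Sum>\<^sub>\<infinity>a\<in>elems A. epowr (sup_dist (fst a) (fst (\<gamma> a))) p) +
     (\<Sum>\<^sub>\<infinity>b\<in>elems B - \<gamma> ` elems A. ennreal (f (sup_dist (fst b) (diag_proj (fst b))) powr p))"

definition wasserstein_div ::
    "real \<Rightarrow> (ennreal \<Rightarrow> real) \<Rightarrow> diagram \<Rightarrow> diagram \<Rightarrow> ennreal" where
  "wasserstein_div p f A B = epowr (INF \<gamma>\<in>injections A B. matching_cost p f A B \<gamma>) (1 / p)"

end

theory Submission
  imports Defs
begin

text \<open>
  Call a point essential if it lies off the diagonal and has an infinite coordinate. A point of
  \<open>C \<in> finite_diagrams\<close> is at infinite distance from every essential point of \<open>A\<close>; this includes
  the diagonal point \<open>(\<infinity>, \<infinity>)\<close>, because an essential point of \<open>A\<close> has a finite first coordinate.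
  So a matching of finite cost leaves all essential points of \<open>A\<close> unmatched, and its cost is at
  least the amount \<open>K\<close> that they contribute as unmatched points (\<open>essential_cost_le\<close>). Including
  the finite part of \<open>A\<close> into \<open>A\<close> costs exactly \<open>K\<close>, which is finite because there are only
  finitely many essential points and \<open>f\<close> has finite values. This is minimality.

  For uniqueness, suppose that matchings from \<open>C\<close> to \<open>A\<close> have costs arbitrarily close to \<open>K\<close>; the
  infimum need not be attained. Fix a finite off-diagonal point \<open>z\<close>. The off-diagonal part of a
  diagram is finite and the diagonal is closed, so \<open>z\<close> is at a positive distance from all other
  points of \<open>A\<close> and of \<open>C\<close> (\<open>separation\<close>), and \<open>f\<close> is positive at its distance to the diagonal. If
  a matching costs less than \<open>K\<close> plus the resulting \<open>\<epsilon>\<close>, then the copies of \<open>z\<close> in \<open>C\<close> go to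
  copies of \<open>z\<close> in \<open>A\<close>, no copy of \<open>z\<close> in \<open>A\<close> is left unmatched, and none is the image of another
  point of \<open>C\<close>. So the matching is a bijection between the copies of \<open>z\<close>, and \<open>z\<close> has the same
  multiplicity in \<open>C\<close> and in \<open>A\<close> (\<open>multiplicity_eq_of_optimal\<close>).
\<close>

section \<open>Powers of extended nonnegative reals\<close>

lemma epowr_mono:
  assumes "0 \<le> q" "x \<le> y"
  shows "epowr x q \<le> epowr y q"
proof (cases "y = \<infinity>")
  case True
  then show ?thesis by (simp add: epowr_def)
next
  case False
  then have "x \<noteq> \<infinity>" using assms(2) by (auto simp: top_unique)
  moreover have "enn2real x \<le> enn2real y"
    using assms(2) False by (intro enn2real_mono) (auto simp: less_top)
  ultimately show ?thesis
    using False assms(1) by (auto simp: epowr_def intro!: ennreal_leI powr_mono2)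
qed

lemma epowr_epowr_inverse:
  assumes "0 < q"
  shows "epowr (epowr x q) (1 / q) = x"
proof (cases "x = \<infinity>")
  case True
  then show ?thesis by (simp add: epowr_def)
next
  case False
  then show ?thesis
    using assms by (simp add: epowr_def powr_powr less_top)
qed

lemma epowr_eq_iff:
  assumes "0 < q"
  shows "epowr x q = epowr y q \<longleftrightarrow> x = y"
  using epowr_epowr_inverse[OF assms] by metis

lemma epowr_pos:
  assumes "0 < x"
  shows "0 < epowr x q"
  using assms by (auto simp: epowr_def enn2real_eq_0_iff less_top)

lemma ennreal_le_infsum:
  fixes g :: "'a \<Rightarrow> ennreal"
  assumes "a \<in> S"
  shows "g a \<le> infsum g S"
proof -
  have "infsum g {a} \<le> infsum g S"
    by (rule infsum_mono_neutral) (use assms in \<open>auto intro: nonneg_summable_on_complete\<close>)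
  then show ?thesis by simp
qed

section \<open>Distances between points\<close>

lemma coord_dist_commute: "coord_dist x y = coord_dist y x"
  unfolding coord_dist_def by (cases x; cases y) (auto simp: abs_minus_commute)

lemma sup_dist_commute: "sup_dist a b = sup_dist b a"
  unfolding sup_dist_def by (simp add: coord_dist_commute)

lemma sup_dist_self:
  assumes "fst a \<in> Rbar" "snd a \<in> Rbar"
  shows "sup_dist a a = 0"
  using assms unfolding sup_dist_def coord_dist_def Rbar_def
  by (cases "fst a"; cases "snd a") (auto simp: zero_ereal_def)

lemma coord_dist_pos:
  assumes "x \<noteq> y"
  shows "0 < coord_dist x y"
  using assms unfolding coord_dist_def
  by (cases x; cases y) (auto simp: zero_less_iff_neq_zero)

lemma sup_dist_pos:
  assumes "a \<noteq> b"
  shows "0 < sup_dist a b"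
  using assms coord_dist_pos unfolding sup_dist_def
  by (metis less_max_iff_disj prod.expand)

lemma coord_dist_infinity:
  assumes "\<bar>x\<bar> \<noteq> \<infinity>"
  shows "coord_dist x \<infinity> = \<infinity>"
  using assms unfolding coord_dist_def by (cases x) auto

text \<open>By the triangle inequality, one of \<open>|x - t|\<close> and \<open>|y - t|\<close> is at least half the persistence
  \<open>y - x\<close> if \<open>t\<close> is finite; both are infinite if \<open>t = \<infinity>\<close>.\<close>

lemma half_persistence_le_sup_dist_diagonal:
  assumes "d \<in> diagonal"
  shows "ennreal ((y - x) / 2) \<le> sup_dist (ereal x, ereal y) d"
proof -
  obtain t where t: "d = (t, t)" "t \<noteq> -\<infinity>"
    using assms unfolding diagonal_def Rbar_def by auto
  show ?thesis
  proof (cases t)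
    case (real r)
    have "(y - x) / 2 \<le> max \<bar>x - r\<bar> \<bar>y - r\<bar>" by (simp add: max_def abs_if)
    then have "ennreal ((y - x) / 2) \<le> ennreal (max \<bar>x - r\<bar> \<bar>y - r\<bar>)" by (rule ennreal_leI)
    also have "\<dots> = sup_dist (ereal x, ereal y) d"
      using t(1) real by (simp add: sup_dist_def coord_dist_def max_def ennreal_le_iff2)
    finally show ?thesis .
  next
    case PInf
    then show ?thesis
      using t by (simp add: sup_dist_def coord_dist_infinity)
  qed (use t in auto)
qed

lemma sup_dist_diag_proj:
  assumes "x < y"
  shows "sup_dist (ereal x, ereal y) (diag_proj (ereal x, ereal y)) = ennreal ((y - x) / 2)"
proof -
  have "(ereal x + ereal y) / 2 = ereal ((x + y) / 2)"
    by (simp add: divide_ereal_def)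
  moreover have "\<bar>x - (x + y) / 2\<bar> = (y - x) / 2" "\<bar>y - (x + y) / 2\<bar> = (y - x) / 2"
    using assms by (auto simp: abs_if field_simps)
  ultimately show ?thesis
    by (simp only: sup_dist_def coord_dist_def diag_proj_def prod.case fst_conv snd_conv
        ereal_minus abs_ereal.simps e2ennreal_ereal) simp
qed

section \<open>Off-diagonal and essential points of a diagram\<close>

lemma diagram_cases:
  assumes "D \<in> diagrams"
  obtains M where "D = add_diagonal M"
    "\<And>x y. (x, y) \<in># M \<Longrightarrow> x \<in> Rbar \<and> y \<in> Rbar \<and> x < y"
  using assms unfolding diagrams_def by fastforce

lemma support_diagram:
  assumes "D = add_diagonal M" "D z \<noteq> 0"
  shows "z \<in># M \<or> z \<in> diagonal"
  using assms by (auto simp: add_diagonal_def zero_enat_def not_in_iff split: if_splits)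

lemma diagram_diagonal:
  assumes "D \<in> diagrams" "z \<in> diagonal"
  shows "D z = \<infinity>"
  using assms by (auto elim!: diagram_cases simp: add_diagonal_def)

lemma diagram_off_diagonal_finite:
  assumes "D \<in> diagrams" "z \<notin> diagonal"
  shows "D z \<noteq> \<infinity>"
  using assms by (auto elim!: diagram_cases simp: add_diagonal_def)

lemma diagram_off_diagonal:
  assumes "D \<in> diagrams" "D (x, y) \<noteq> 0" "(x, y) \<notin> diagonal"
  shows "\<bar>x\<bar> \<noteq> \<infinity>" "x < y"
proof -
  obtain M where M: "D = add_diagonal M"
    "\<And>x y. (x, y) \<in># M \<Longrightarrow> x \<in> Rbar \<and> y \<in> Rbar \<and> x < y"
    using diagram_cases[OF assms(1)] by blast
  then have *: "x \<in> Rbar \<and> y \<in> Rbar \<and> x < y"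
    using support_diagram[OF M(1) assms(2)] assms(3) by blast
  then show "x < y" by simp
  show "\<bar>x\<bar> \<noteq> \<infinity>" using * by (cases x) (auto simp: Rbar_def)
qed

lemma diagram_support_Rbar:
  assumes "D \<in> diagrams" "D (x, y) \<noteq> 0"
  shows "x \<in> Rbar" "y \<in> Rbar"
proof -
  obtain M where M: "D = add_diagonal M"
    "\<And>x y. (x, y) \<in># M \<Longrightarrow> x \<in> Rbar \<and> y \<in> Rbar \<and> x < y"
    using diagram_cases[OF assms(1)] by blast
  then have "x \<in> Rbar \<and> y \<in> Rbar"
    using support_diagram[OF M(1) assms(2)] by (auto simp: diagonal_def)
  then show "x \<in> Rbar" "y \<in> Rbar" by auto
qed

definition essential :: "(ereal \<times> ereal) set" where
  "essential = {(x, y). (x, y) \<notin> diagonal \<and> (\<bar>x\<bar> = \<infinity> \<or> \<bar>y\<bar> = \<infinity>)}"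

definition essential_elems :: "diagram \<Rightarrow> ((ereal \<times> ereal) \<times> nat) set" where
  "essential_elems D = {a \<in> elems D. fst a \<in> essential}"

lemma essential_off_diagonal: "z \<in> essential \<Longrightarrow> z \<notin> diagonal"
  by (cases z) (simp add: essential_def)

lemma remove_infinite_apply:
  "remove_infinite D z = (if z \<in> essential then 0 else D z)"
  by (cases z) (auto simp: remove_infinite_def essential_def)

lemma finite_diagrams_iff:
  "D \<in> finite_diagrams \<longleftrightarrow> D \<in> diagrams \<and> (\<forall>z\<in>essential. D z = 0)"
proof -
  have "(\<forall>x y. D (x, y) \<noteq> 0 \<and> (x, y) \<notin> diagonal \<longrightarrow> \<bar>x\<bar> \<noteq> \<infinity> \<and> \<bar>y\<bar> \<noteq> \<infinity>) \<longleftrightarrow>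
      (\<forall>x y. (x, y) \<in> essential \<longrightarrow> D (x, y) = 0)"
    unfolding essential_def by (intro iff_allI) auto
  then show ?thesis
    unfolding finite_diagrams_def by auto
qed

lemma remove_infinite_in_finite_diagrams:
  assumes "D \<in> diagrams"
  shows "remove_infinite D \<in> finite_diagrams"
proof -
  obtain M where M: "D = add_diagonal M"
    "\<And>x y. (x, y) \<in># M \<Longrightarrow> x \<in> Rbar \<and> y \<in> Rbar \<and> x < y"
    using diagram_cases[OF assms] by blast
  let ?N = "filter_mset (\<lambda>z. z \<notin> essential) M"
  have "remove_infinite D = add_diagonal ?N"
    by (rule ext) (simp add: remove_infinite_apply M(1) add_diagonal_def essential_off_diagonal
        zero_enat_def)
  moreover have "\<forall>(x, y)\<in>set_mset ?N. x \<in> Rbar \<and> y \<in> Rbar \<and> x < y"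
    using M(2) by auto
  ultimately have "remove_infinite D \<in> diagrams"
    unfolding diagrams_def by blast
  then show ?thesis
    by (simp add: finite_diagrams_iff remove_infinite_apply)
qed

lemma elems_remove_infinite: "elems (remove_infinite D) = elems D - essential_elems D"
  by (auto simp: elems_def essential_elems_def remove_infinite_apply split: if_splits)

lemma finite_essential_elems:
  assumes "D \<in> diagrams"
  shows "finite (essential_elems D)"
proof -
  obtain M where M: "D = add_diagonal M"
    using diagram_cases[OF assms] by blast
  have "essential_elems D \<subseteq> (SIGMA z:set_mset M. {..<count M z})"
    by (auto simp: essential_elems_def elems_def essential_def M add_diagonal_def
        zero_enat_def count_greater_zero_iff[symmetric] simp del: count_greater_zero_iff)
  then show ?thesis by (rule finite_subset) auto
qed

text \<open>The finitely many off-diagonal points are handled one by one. The diagonal has infinitely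
  many points near \<open>z\<close>, and for them half the persistence of \<open>z\<close> serves as a uniform bound.\<close>

lemma separation:
  assumes "D \<in> diagrams" "x < y" "0 \<le> p"
  shows "\<exists>\<epsilon>>0. \<forall>w. D w \<noteq> 0 \<and> w \<noteq> (ereal x, ereal y) \<longrightarrow>
           \<epsilon> \<le> epowr (sup_dist (ereal x, ereal y) w) p"
proof -
  let ?z = "(ereal x, ereal y)"
  obtain M where M: "D = add_diagonal M"
    using diagram_cases[OF assms(1)] by blast
  let ?S = "insert (ennreal ((y - x) / 2)) ((\<lambda>w. sup_dist ?z w) ` (set_mset M - {?z}))"
  define \<delta> where "\<delta> = Min ?S"
  have "0 < \<delta>"
    unfolding \<delta>_def using assms(2) by (subst Min_gr_iff) (auto intro!: sup_dist_pos simp del: prod.inject)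
  have "\<delta> \<le> sup_dist ?z w" if w: "D w \<noteq> 0" "w \<noteq> ?z" for w
    using support_diagram[OF M w(1)]
  proof
    assume "w \<in># M"
    then show ?thesis
      unfolding \<delta>_def using w(2) by (intro Min_le) auto
  next
    assume "w \<in> diagonal"
    moreover have "\<delta> \<le> ennreal ((y - x) / 2)"
      unfolding \<delta>_def by (intro Min_le) auto
    ultimately show ?thesis
      using half_persistence_le_sup_dist_diagonal order_trans by blast
  qed
  then show ?thesis
    using \<open>0 < \<delta>\<close> assms(3) by (intro exI[of _ "epowr \<delta> p"]) (auto intro: epowr_pos epowr_mono)
qed

section \<open>The cost of a matching and the essential points\<close>

definition essential_cost :: "real \<Rightarrow> (ennreal \<Rightarrow> real) \<Rightarrow> diagram \<Rightarrow> ennreal" where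
  "essential_cost p f A =
     (\<Sum>\<^sub>\<infinity>b\<in>essential_elems A. ennreal (f (sup_dist (fst b) (diag_proj (fst b))) powr p))"

lemma essential_cost_finite:
  assumes "A \<in> diagrams"
  shows "essential_cost p f A < \<infinity>"
  unfolding essential_cost_def using finite_essential_elems[OF assms] by simp

text \<open>An essential point of a diagram is \<open>(x, \<infinity>)\<close> with \<open>x\<close> finite. A point of \<open>C\<close> that is not
  infinitely far from it in the second coordinate has second coordinate \<open>\<infinity>\<close>; it can then only be
  the diagonal point \<open>(\<infinity>, \<infinity>)\<close>, which is infinitely far in the first coordinate.\<close>

lemma sup_dist_essential:
  assumes "C \<in> finite_diagrams" "A \<in> diagrams" "C w \<noteq> 0" "A z \<noteq> 0" "z \<in> essential"
  shows "sup_dist w z = \<infinity>"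
proof -
  obtain x y u v where z: "z = (x, y)" and w: "w = (u, v)" by (meson surj_pair)
  have x: "\<bar>x\<bar> \<noteq> \<infinity>" and y: "y = \<infinity>"
    using diagram_off_diagonal[of A x y] assms(2,4,5) diagram_support_Rbar(2)[of A x y]
    by (auto simp: z essential_def Rbar_def)
  have "w \<notin> essential" using assms(1,3) by (auto simp: finite_diagrams_iff)
  then have "(u, v) \<in> diagonal \<or> \<bar>v\<bar> \<noteq> \<infinity>"
    by (auto simp: w essential_def)
  moreover have "v \<noteq> -\<infinity>"
    using diagram_support_Rbar(2)[of C u v] assms(1,3)
    by (simp add: w Rbar_def finite_diagrams_iff)
  ultimately have "\<bar>v\<bar> \<noteq> \<infinity> \<or> u = \<infinity>"
    unfolding diagonal_def by (cases v) auto
  then show ?thesis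
  proof
    assume "\<bar>v\<bar> \<noteq> \<infinity>"
    then show ?thesis by (simp add: z w y sup_dist_def coord_dist_infinity)
  next
    assume "u = \<infinity>"
    then show ?thesis
      using coord_dist_infinity[OF x] by (simp add: z w sup_dist_def coord_dist_commute[of "\<infinity>"])
  qed
qed

lemma essential_elems_unmatched:
  assumes "C \<in> finite_diagrams" "A \<in> diagrams" "\<gamma> \<in> injections C A"
    and cost: "matching_cost p f C A \<gamma> \<noteq> \<infinity>"
  shows "essential_elems A \<subseteq> elems A - \<gamma> ` elems C"
proof -
  have "\<gamma> a \<notin> essential_elems A" if a: "a \<in> elems C" for a
  proof
    assume *: "\<gamma> a \<in> essential_elems A"
    have "C (fst a) \<noteq> 0" "A (fst (\<gamma> a)) \<noteq> 0"
      using a * by (auto simp: essential_elems_def elems_def)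
    then have "epowr (sup_dist (fst a) (fst (\<gamma> a))) p = \<infinity>"
      using sup_dist_essential[OF assms(1,2)] * by (auto simp: essential_elems_def epowr_def)
    then have "matching_cost p f C A \<gamma> = \<infinity>"
      using ennreal_le_infsum[OF a, of "\<lambda>a. epowr (sup_dist (fst a) (fst (\<gamma> a))) p"]
      by (simp add: matching_cost_def top_unique)
    then show False using cost by simp
  qed
  then show ?thesis by (auto simp: essential_elems_def)
qed

text \<open>The gap above \<open>essential_cost\<close> is what the uniqueness proof makes small. Here the essential
  points and \<open>b\<close> are distinct summands of the second sum in the cost; in the next lemma the
  essential points contribute to the second sum and \<open>a\<close> to the first.\<close>

lemma essential_cost_plus_unmatched_le:
  assumes "C \<in> finite_diagrams" "A \<in> diagrams" "\<gamma> \<in> injections C A"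
    and b: "b \<in> elems A - \<gamma> ` elems C" "b \<notin> essential_elems A"
  shows "essential_cost p f A + ennreal (f (sup_dist (fst b) (diag_proj (fst b))) powr p)
    \<le> matching_cost p f C A \<gamma>"
proof (cases "matching_cost p f C A \<gamma> = \<infinity>")
  case False
  let ?g = "\<lambda>b. ennreal (f (sup_dist (fst b) (diag_proj (fst b))) powr p)"
  have "essential_cost p f A + ?g b = infsum ?g (insert b (essential_elems A))"
    using b(2) finite_essential_elems[OF assms(2)] by (simp add: essential_cost_def add.commute del: sum_ennreal)
  also have "\<dots> \<le> infsum ?g (elems A - \<gamma> ` elems C)"
    using essential_elems_unmatched[OF assms(1-3) False] b(1)
    by (intro infsum_mono_neutral) (auto intro: nonneg_summable_on_complete)
  also have "\<dots> \<le> matching_cost p f C A \<gamma>"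
    by (simp add: matching_cost_def)
  finally show ?thesis .
qed simp

lemma essential_cost_plus_matched_le:
  assumes "C \<in> finite_diagrams" "A \<in> diagrams" "\<gamma> \<in> injections C A" "a \<in> elems C"
  shows "essential_cost p f A + epowr (sup_dist (fst a) (fst (\<gamma> a))) p \<le> matching_cost p f C A \<gamma>"
proof (cases "matching_cost p f C A \<gamma> = \<infinity>")
  case False
  have "essential_cost p f A \<le>
      (\<Sum>\<^sub>\<infinity>b\<in>elems A - \<gamma> ` elems C. ennreal (f (sup_dist (fst b) (diag_proj (fst b))) powr p))"
    unfolding essential_cost_def using essential_elems_unmatched[OF assms(1-3) False]
    by (intro infsum_mono_neutral) (auto intro: nonneg_summable_on_complete)
  moreover have "epowr (sup_dist (fst a) (fst (\<gamma> a))) p \<le>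
      (\<Sum>\<^sub>\<infinity>a\<in>elems C. epowr (sup_dist (fst a) (fst (\<gamma> a))) p)"
    using ennreal_le_infsum[OF assms(4), of "\<lambda>a. epowr (sup_dist (fst a) (fst (\<gamma> a))) p"] .
  ultimately have "epowr (sup_dist (fst a) (fst (\<gamma> a))) p + essential_cost p f A
      \<le> matching_cost p f C A \<gamma>"
    unfolding matching_cost_def by (intro add_mono)
  then show ?thesis
    by (subst add.commute)
qed simp

text \<open>Every diagram contains the diagonal, so \<open>C\<close> has a point whose matching cost can be dropped
  from the preceding bound.\<close>

lemma essential_cost_le:
  assumes "C \<in> finite_diagrams" "A \<in> diagrams" "\<gamma> \<in> injections C A"
  shows "essential_cost p f A \<le> matching_cost p f C A \<gamma>"
proof -
  have "(0, 0) \<in> diagonal" by (simp add: diagonal_def Rbar_def)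
  then have "C (0, 0) = \<infinity>"
    using diagram_diagonal assms(1) by (simp add: finite_diagrams_iff)
  then have "((0, 0), 0) \<in> elems C" by (simp add: elems_def)
  from essential_cost_plus_matched_le[OF assms this] show ?thesis
    by (rule order_trans[rotated]) simp
qed

lemma matching_cost_inclusion:
  assumes "A \<in> diagrams"
  shows "matching_cost p f (remove_infinite A) A id = essential_cost p f A"
proof -
  have "epowr (sup_dist (fst a) (fst (id a))) p = 0" if "a \<in> elems (remove_infinite A)" for a
  proof -
    have "A (fst a) \<noteq> 0"
      using that by (auto simp: elems_def remove_infinite_apply split: if_splits)
    then have "sup_dist (fst a) (fst a) = 0"
      using diagram_support_Rbar[OF assms, of "fst (fst a)" "snd (fst a)"]
      by (intro sup_dist_self) auto
    then show ?thesis by (simp add: epowr_def)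
  qed
  then have "(\<Sum>\<^sub>\<infinity>a\<in>elems (remove_infinite A). epowr (sup_dist (fst a) (fst (id a))) p) = 0"
    by (intro infsum_0) auto
  moreover have "elems A - id ` elems (remove_infinite A) = essential_elems A"
    by (auto simp: elems_remove_infinite essential_elems_def)
  ultimately show ?thesis
    by (simp add: matching_cost_def essential_cost_def)
qed

lemma INF_matching_cost_remove_infinite:
  assumes "A \<in> diagrams"
  shows "(INF \<gamma>\<in>injections (remove_infinite A) A. matching_cost p f (remove_infinite A) A \<gamma>)
    = essential_cost p f A"
proof (rule antisym)
  have "id \<in> injections (remove_infinite A) A"
    by (auto simp: injections_def elems_remove_infinite)
  then show "(INF \<gamma>\<in>injections (remove_infinite A) A. matching_cost p f (remove_infinite A) A \<gamma>)
      \<le> essential_cost p f A"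
    by (rule INF_lower2) (simp add: matching_cost_inclusion[OF assms])
next
  show "essential_cost p f A
      \<le> (INF \<gamma>\<in>injections (remove_infinite A) A. matching_cost p f (remove_infinite A) A \<gamma>)"
    using essential_cost_le[OF remove_infinite_in_finite_diagrams[OF assms] assms]
    by (rule INF_greatest)
qed

section \<open>Rigidity of optimal diagrams\<close>

lemma multiplicity_eq_of_bij:
  assumes fin: "C z \<noteq> \<infinity>" "A z \<noteq> \<infinity>"
    and inj: "inj_on \<gamma> {a \<in> elems C. fst a = z}"
    and img: "\<gamma> ` {a \<in> elems C. fst a = z} = {a \<in> elems A. fst a = z}"
  shows "C z = A z"
proof -
  obtain m n where mn: "C z = enat m" "A z = enat n" using fin by auto
  have "{a \<in> elems C. fst a = z} = {z} \<times> {..<m}" "{a \<in> elems A. fst a = z} = {z} \<times> {..<n}"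
    unfolding elems_def using mn by fastforce+
  then have "card {a \<in> elems C. fst a = z} = m" "card {a \<in> elems A. fst a = z} = n"
    by (simp_all only: card_cartesian_product card_lessThan) simp_all
  then show ?thesis
    using card_image[OF inj] mn unfolding img by simp
qed

text \<open>The three reasons for which a near-optimal matching could fail to be a bijection between the
  copies of \<open>z\<close> in \<open>C\<close> and in \<open>A\<close> each cost a fixed amount: moving a copy of \<open>z\<close>, moving another
  point of \<open>C\<close> to \<open>z\<close>, and leaving a copy of \<open>z\<close> in \<open>A\<close> unmatched.\<close>

lemma multiplicity_eq_of_optimal:
  assumes C: "C \<in> finite_diagrams" and A: "A \<in> diagrams" and p: "0 \<le> p"
    and fpos: "\<And>x. 0 < x \<Longrightarrow> x < \<infinity> \<Longrightarrow> 0 < f x"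
    and opt: "(INF \<gamma>\<in>injections C A. matching_cost p f C A \<gamma>) = essential_cost p f A"
    and xy: "x < y"
  shows "C (ereal x, ereal y) = A (ereal x, ereal y)"
proof -
  let ?z = "(ereal x, ereal y)"
  have C': "C \<in> diagrams" using C by (simp add: finite_diagrams_iff)
  have z: "?z \<notin> diagonal" "?z \<notin> essential"
    using xy by (auto simp: diagonal_def essential_def)
  obtain \<epsilon>1 where \<epsilon>1: "0 < \<epsilon>1"
    "\<And>w. A w \<noteq> 0 \<Longrightarrow> w \<noteq> ?z \<Longrightarrow> \<epsilon>1 \<le> epowr (sup_dist ?z w) p"
    using separation[OF A xy p] by blast
  obtain \<epsilon>2 where \<epsilon>2: "0 < \<epsilon>2"
    "\<And>w. C w \<noteq> 0 \<Longrightarrow> w \<noteq> ?z \<Longrightarrow> \<epsilon>2 \<le> epowr (sup_dist ?z w) p"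
    using separation[OF C' xy p] by blast
  define \<epsilon>3 where "\<epsilon>3 = ennreal (f (sup_dist ?z (diag_proj ?z)) powr p)"
  have "0 < f (sup_dist ?z (diag_proj ?z))"
    using xy by (intro fpos) (auto simp: sup_dist_diag_proj)
  then have \<epsilon>3: "0 < \<epsilon>3" by (simp add: \<epsilon>3_def)
  let ?\<epsilon> = "min \<epsilon>1 (min \<epsilon>2 \<epsilon>3)"
  have "essential_cost p f A + 0 < essential_cost p f A + ?\<epsilon>"
    using essential_cost_finite[OF A] \<epsilon>1(1) \<epsilon>2(1) \<epsilon>3
    by (subst ennreal_add_left_cancel_less) (auto simp: less_top)
  then have "(INF \<gamma>\<in>injections C A. matching_cost p f C A \<gamma>) < essential_cost p f A + ?\<epsilon>"
    unfolding opt by simp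
  then obtain \<gamma> where \<gamma>: "\<gamma> \<in> injections C A"
    and less: "matching_cost p f C A \<gamma> < essential_cost p f A + ?\<epsilon>"
    unfolding INF_less_iff by blast
  have close: "epowr (sup_dist (fst a) (fst (\<gamma> a))) p < \<epsilon>1"
    "epowr (sup_dist (fst a) (fst (\<gamma> a))) p < \<epsilon>2" if "a \<in> elems C" for a
    using order_le_less_trans[OF essential_cost_plus_matched_le[OF C A \<gamma> that] less]
    unfolding ennreal_add_left_cancel_less by simp_all
  have nonzero: "C (fst a) \<noteq> 0" "A (fst (\<gamma> a)) \<noteq> 0" "\<gamma> a \<in> elems A" if "a \<in> elems C" for a
  proof -
    show "\<gamma> a \<in> elems A" using that \<gamma> by (auto simp: injections_def)
    then show "C (fst a) \<noteq> 0" "A (fst (\<gamma> a)) \<noteq> 0"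
      using that by (auto simp: elems_def)
  qed
  have stay: "fst (\<gamma> a) = ?z \<longleftrightarrow> fst a = ?z" if a: "a \<in> elems C" for a
  proof
    assume "fst a = ?z"
    then show "fst (\<gamma> a) = ?z"
      using close(1)[OF a] \<epsilon>1(2)[OF nonzero(2)[OF a]] by (metis not_le)
  next
    assume "fst (\<gamma> a) = ?z"
    then show "fst a = ?z"
      using close(2)[OF a] \<epsilon>2(2)[OF nonzero(1)[OF a]] sup_dist_commute[of "fst a" ?z]
      by (metis not_le)
  qed
  have matched: "b \<in> \<gamma> ` elems C" if b: "b \<in> elems A" "fst b = ?z" for b
  proof (rule ccontr)
    assume "b \<notin> \<gamma> ` elems C"
    then have "essential_cost p f A + \<epsilon>3 \<le> matching_cost p f C A \<gamma>"
      using essential_cost_plus_unmatched_le[OF C A \<gamma>, of b p f] b z(2)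
      by (simp add: \<epsilon>3_def essential_elems_def)
    then have "essential_cost p f A + \<epsilon>3 < essential_cost p f A + ?\<epsilon>"
      using less by (rule order_le_less_trans)
    then show False
      unfolding ennreal_add_left_cancel_less by simp
  qed
  show ?thesis
  proof (rule multiplicity_eq_of_bij)
    show "C ?z \<noteq> \<infinity>" "A ?z \<noteq> \<infinity>"
      using diagram_off_diagonal_finite C' A z(1) by auto
    show "inj_on \<gamma> {a \<in> elems C. fst a = ?z}"
      using \<gamma> by (auto simp: injections_def intro: inj_on_subset)
    show "\<gamma> ` {a \<in> elems C. fst a = ?z} = {a \<in> elems A. fst a = ?z}"
    proof
      show "\<gamma> ` {a \<in> elems C. fst a = ?z} \<subseteq> {a \<in> elems A. fst a = ?z}"
        using stay nonzero(3) by auto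
      show "{a \<in> elems A. fst a = ?z} \<subseteq> \<gamma> ` {a \<in> elems C. fst a = ?z}"
      proof
        fix b assume b: "b \<in> {a \<in> elems A. fst a = ?z}"
        then obtain a where "a \<in> elems C" "b = \<gamma> a" using matched[of b] by blast
        then show "b \<in> \<gamma> ` {a \<in> elems C. fst a = ?z}" using stay b by blast
      qed
    qed
  qed
qed

lemma eq_remove_infinite_of_optimal:
  assumes C: "C \<in> finite_diagrams" and A: "A \<in> diagrams" and p: "0 \<le> p"
    and fpos: "\<And>x. 0 < x \<Longrightarrow> x < \<infinity> \<Longrightarrow> 0 < f x"
    and opt: "(INF \<gamma>\<in>injections C A. matching_cost p f C A \<gamma>) = essential_cost p f A"
  shows "C = remove_infinite A"
proof
  fix z :: "ereal \<times> ereal"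
  obtain x y where z: "z = (x, y)" by (cases z)
  have C': "C \<in> diagrams" using C by (simp add: finite_diagrams_iff)
  consider "z \<in> essential" | "z \<in> diagonal" | "z \<notin> diagonal" "z \<notin> essential" by blast
  then show "C z = remove_infinite A z"
  proof cases
    case 1
    then show ?thesis using C by (simp add: finite_diagrams_iff remove_infinite_apply)
  next
    case 2
    moreover have "z \<notin> essential" using 2 essential_off_diagonal by blast
    ultimately show ?thesis
      using diagram_diagonal[OF C'] diagram_diagonal[OF A] by (simp add: remove_infinite_apply)
  next
    case 3
    have "\<bar>x\<bar> \<noteq> \<infinity>" "\<bar>y\<bar> \<noteq> \<infinity>"
      using 3 by (auto simp: z essential_def)
    then obtain u v where uv: "x = ereal u" "y = ereal v"
      by (cases x; cases y) auto
    have "C z = A z"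
    proof (cases "u < v")
      case True
      show ?thesis
        unfolding z uv by (rule multiplicity_eq_of_optimal[OF C A p fpos opt True])
    next
      case False
      have "D z = 0" if "D \<in> diagrams" for D
        using diagram_off_diagonal(2)[OF that, of x y] 3(1) False unfolding z uv by auto
      from this[OF C'] this[OF A] show ?thesis by simp
    qed
    then show ?thesis using 3 by (simp add: remove_infinite_apply)
  qed
qed

(* The finite part of A is a minimizer for every admissible f. Uniqueness needs f to vanish only
   at 0: if f t = 0 with 0 < t < \<infinity> (for example f = 0) and A has the single off-diagonal point
   (0, 2 t), then both A and the empty diagram are at divergence 0 from A. *)
theorem theorem4p1:
  fixes p :: real and f :: "ennreal \<Rightarrow> real" and A :: diagram
  assumes "1 \<le> p" and "subdiag_subadd f" and "A \<in> diagrams"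
  shows "(remove_infinite A \<in> finite_diagrams \<and>
          wasserstein_div p f (remove_infinite A) A
            = (INF C\<in>finite_diagrams. wasserstein_div p f C A)) \<and>
         ((\<forall>x. 0 < x \<and> x < \<infinity> \<longrightarrow> 0 < f x) \<longrightarrow>
          (\<exists>!B. B \<in> finite_diagrams \<and>
             wasserstein_div p f B A = (INF C\<in>finite_diagrams. wasserstein_div p f C A)))"
proof -
  let ?B = "remove_infinite A"
  have B: "?B \<in> finite_diagrams"
    using remove_infinite_in_finite_diagrams[OF assms(3)] .
  have cost_B: "wasserstein_div p f ?B A = epowr (essential_cost p f A) (1 / p)"
    using INF_matching_cost_remove_infinite[OF assms(3)] by (simp add: wasserstein_div_def)
  have "wasserstein_div p f ?B A \<le> wasserstein_div p f C A" if "C \<in> finite_diagrams" for C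
    unfolding cost_B unfolding wasserstein_div_def
    using assms(1) essential_cost_le[OF that assms(3)]
    by (intro epowr_mono INF_greatest) auto
  then have opt: "wasserstein_div p f ?B A = (INF C\<in>finite_diagrams. wasserstein_div p f C A)"
    using B by (intro antisym INF_greatest INF_lower) auto
  have unique: "C = ?B"
    if fpos: "\<forall>x. 0 < x \<and> x < \<infinity> \<longrightarrow> 0 < f x" and C: "C \<in> finite_diagrams"
      and eq: "wasserstein_div p f C A = (INF C\<in>finite_diagrams. wasserstein_div p f C A)" for C
  proof (rule eq_remove_infinite_of_optimal[OF C assms(3)])
    show "(INF \<gamma>\<in>injections C A. matching_cost p f C A \<gamma>) = essential_cost p f A"
      using eq cost_B assms(1) unfolding opt[symmetric]
      by (simp add: wasserstein_div_def epowr_eq_iff)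
  qed (use assms(1) fpos in auto)
  show ?thesis
    using B opt unique by blast
qed

end
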